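(* Let $G=(V,E)$ be a 2-edge-connected undirected multigraph and let $E'\subseteq E$ be a minimal 2-edge-connected spanning subgraph of $G$ (i.e., $(V,E')$ is 2-edge-connected and no proper subset of $E'$ spanning $V$ is). Let $F\subseteq E$ be an edge set forming a (not necessarily spanning) forest in $G$ such that every edge $e\in E'\setminus F$ is essential in $(V,E'\cup F)$. Let $L_0:=V\setminus V(F)$, $L_1:=\{v\in V(F)\mid \deg_F(v)=1,\ \delta_F(v)\subseteq E'\}$, $L_2:=\{v\in V(F)\mid \deg_F(v)=1,\ \delta_F(v)\cap E'=\varnothing\}$, and $L:=L_0\cup L_1\cup L_2$. Then $$\sum_{v\in L}\deg_{E'}(v)\;\le\;3\,(|L|+|L_0|)+|L_1|.$$
   Context: A multigraph (parallel edges allowed, edges identified by name) is 2-edge-connected if for every edge $e$ the graph obtained by deleting $e$ is connected. In a 2-edge-connected multigraph $H$, an edge $e$ is essential if $H$ with $e$ deleted is not 2-edge-connected. For an edge set $H$, $V(H)$ is the set of nodes incident to edges of $H$, $\delta_H(v)$ is the set of edges of $H$ incident to $v$, and $\deg_H(v):=|\delta_H(v)|$. *)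

theory Defs
  imports Main
begin

text \<open>
  Edges are names of type \<open>'e\<close>, and \<open>ends\<close> maps a name to its set of end nodes: two edges are
  parallel iff they have the same ends, and a loop has a singleton set of ends.  A subgraph on the
  node set \<open>V\<close> is given by a set of edge names.
\<close>

definition multigraph :: "'v set \<Rightarrow> 'e set \<Rightarrow> ('e \<Rightarrow> 'v set) \<Rightarrow> bool" where
  "multigraph V E ends \<longleftrightarrow>
     finite V \<and> finite E \<and> (\<forall>e\<in>E. \<exists>u\<in>V. \<exists>v\<in>V. ends e = {u, v})"

definition adj_rel :: "('e \<Rightarrow> 'v set) \<Rightarrow> 'e set \<Rightarrow> ('v \<times> 'v) set" where
  "adj_rel ends H = {(u, v). \<exists>e\<in>H. ends e = {u, v}}"

definition connected_graph :: "('e \<Rightarrow> 'v set) \<Rightarrow> 'v set \<Rightarrow> 'e set \<Rightarrow> bool" where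
  "connected_graph ends V H \<longleftrightarrow> (\<forall>u\<in>V. \<forall>v\<in>V. (u, v) \<in> (adj_rel ends H)\<^sup>*)"

text \<open>
  Connectedness is a separate conjunct because the condition on deleted edges is vacuous for an
  edgeless graph; for every other graph it follows from that condition.
\<close>

definition two_edge_connected :: "('e \<Rightarrow> 'v set) \<Rightarrow> 'v set \<Rightarrow> 'e set \<Rightarrow> bool" where
  "two_edge_connected ends V H \<longleftrightarrow>
     connected_graph ends V H \<and> (\<forall>e\<in>H. connected_graph ends V (H - {e}))"

definition essential :: "('e \<Rightarrow> 'v set) \<Rightarrow> 'v set \<Rightarrow> 'e set \<Rightarrow> 'e \<Rightarrow> bool" where
  "essential ends V H e \<longleftrightarrow>
     two_edge_connected ends V H \<and> e \<in> H \<and> \<not> two_edge_connected ends V (H - {e})"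

definition minimal_2ec_spanning ::
    "('e \<Rightarrow> 'v set) \<Rightarrow> 'v set \<Rightarrow> 'e set \<Rightarrow> 'e set \<Rightarrow> bool" where
  "minimal_2ec_spanning ends V E E' \<longleftrightarrow>
     E' \<subseteq> E \<and> two_edge_connected ends V E' \<and>
     (\<forall>H. H \<subset> E' \<longrightarrow> \<not> two_edge_connected ends V H)"

text \<open>A loop is a cycle of length 1 and a pair of parallel edges is a cycle of length 2.\<close>

definition is_cycle :: "('e \<Rightarrow> 'v set) \<Rightarrow> 'e set \<Rightarrow> 'v list \<Rightarrow> 'e list \<Rightarrow> bool" where
  "is_cycle ends H vs es \<longleftrightarrow>
     es \<noteq> [] \<and> length vs = length es \<and> distinct vs \<and> distinct es \<and> set es \<subseteq> H \<and>
     (\<forall>i < length es. ends (es ! i) = {vs ! i, vs ! (Suc i mod length es)})"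

definition forest :: "('e \<Rightarrow> 'v set) \<Rightarrow> 'e set \<Rightarrow> bool" where
  "forest ends H \<longleftrightarrow> \<not> (\<exists>vs es. is_cycle ends H vs es)"

definition nodes_of :: "('e \<Rightarrow> 'v set) \<Rightarrow> 'e set \<Rightarrow> 'v set" where
  "nodes_of ends H = (\<Union>e\<in>H. ends e)"

definition incident_edges :: "('e \<Rightarrow> 'v set) \<Rightarrow> 'e set \<Rightarrow> 'v \<Rightarrow> 'e set" where
  "incident_edges ends H v = {e \<in> H. v \<in> ends e}"

definition edge_degree :: "('e \<Rightarrow> 'v set) \<Rightarrow> 'e set \<Rightarrow> 'v \<Rightarrow> nat" where
  "edge_degree ends H v = card (incident_edges ends H v)"

end

theory Submission
  imports Defs
begin

text \<open>
  Put \<open>H = E' \<union> F\<close> and \<open>D = H - F\<close>. An edge is essential iff it lies in a two-edge cut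
  of \<open>H\<close>. Let \<open>D1\<close> be the edges of \<open>D\<close> whose two-edge cuts all have their second edge in \<open>F\<close>, and
  choose one such second edge, the partner, for each of them. Let \<open>R\<close> be \<open>D\<close> together with the
  partners and identify nodes that no two-edge cut inside \<open>R\<close> separates. In the quotient, on \<open>N\<close>
  classes, exactly the edges of \<open>R\<close> survive, each edge of \<open>D1\<close> is parallel to its partner, and
  \<open>|D| + |D1| = |R| \<le> 2 (N - 1)\<close>, since two edge-disjoint spanning forests already exhaust \<open>R\<close>.

  Give a node \<open>v\<close> the deficiency \<open>2 - deg\<^sub>F v\<close> (truncated at 0); the total \<open>W\<close> is \<open>|L| + |L0|\<close>.
  As \<open>F\<close> is a forest, the deficiency of a class plus its degree in \<open>D1\<close> is at least 2. Summing
  over all classes gives \<open>2 N \<le> W + 2 |D1|\<close>, hence \<open>2 |D| \<le> 2 N + W\<close>; and a class that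
  misses \<open>L\<close> has degree at least 2 in \<open>D\<close>. So the classes meeting \<open>L\<close>, of which there are at most
  \<open>W\<close>, have total degree at most \<open>3 W\<close> in \<open>D\<close>. The edges of \<open>E' \<inter> F\<close> contribute at most \<open>|L1|\<close>.
\<close>

section \<open>Spanning forests and edge counts\<close>

lemma adj_rel_mono: "T \<subseteq> T' \<Longrightarrow> adj_rel ends T \<subseteq> adj_rel ends T'"
  by (auto simp: adj_rel_def)

lemma adj_relI: "e \<in> T \<Longrightarrow> ends e = {u, v} \<Longrightarrow> (u, v) \<in> adj_rel ends T"
  by (auto simp: adj_rel_def)

lemma sym_adj_rel: "sym (adj_rel ends T)"
  by (auto simp: adj_rel_def sym_def insert_commute)

lemma rtrancl_adj_rel_sym: "(u, v) \<in> (adj_rel ends T)\<^sup>* \<Longrightarrow> (v, u) \<in> (adj_rel ends T)\<^sup>*"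
  using sym_rtrancl[OF sym_adj_rel] by (rule symD)

lemma rtrancl_adj_rel_crossing:
  assumes "(x, y) \<in> (adj_rel ends T)\<^sup>*" "P x" "\<not> P y"
  shows "\<exists>t\<in>T. \<exists>a b. ends t = {a, b} \<and> P a \<and> \<not> P b"
  using assms by (induction rule: rtrancl_induct) (auto simp: adj_rel_def)

text \<open>Greedy selection: an edge is kept only if the edges kept so far do not join its ends, so
  each kept edge lowers the number of components.\<close>

lemma spanning_subset_component_count:
  assumes "finite B" "finite A" "\<And>e. e \<in> B \<Longrightarrow> \<exists>u\<in>A. \<exists>v\<in>A. ends e = {u, v}"
  shows "\<exists>T\<subseteq>B. card T + card ((\<lambda>v. (adj_rel ends T)\<^sup>* `` {v}) ` A) \<le> card A \<and>
    adj_rel ends B \<subseteq> (adj_rel ends T)\<^sup>*"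
  using assms
proof (induction B rule: finite_induct)
  case empty
  then show ?case by (auto simp: adj_rel_def intro: card_image_le)
next
  case (insert e B)
  let ?cl = "\<lambda>T v. (adj_rel ends T)\<^sup>* `` {v}"
  obtain T where T: "T \<subseteq> B" "card T + card (?cl T ` A) \<le> card A"
    "adj_rel ends B \<subseteq> (adj_rel ends T)\<^sup>*"
    using insert by auto
  obtain u v where uv: "u \<in> A" "v \<in> A" "ends e = {u, v}"
    using insert.prems by blast
  show ?case
  proof (cases "(u, v) \<in> (adj_rel ends T)\<^sup>*")
    case True
    have "adj_rel ends (insert e B) \<subseteq> (adj_rel ends T)\<^sup>*"
      using T(3) uv(3) True rtrancl_adj_rel_sym[OF True]
      by (auto simp: adj_rel_def doubleton_eq_iff)
    with T show ?thesis by blast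
  next
    case False
    let ?T = "insert e T"
    \<comment> \<open>\<open>?g\<close> sends each old class to the new class containing it. It is
      onto the new classes and merges those of \<open>u\<close> and \<open>v\<close>, so the number
      of classes drops.\<close>
    let ?g = "\<lambda>C. (adj_rel ends ?T)\<^sup>* `` C"
    have sub: "(adj_rel ends T)\<^sup>* \<subseteq> (adj_rel ends ?T)\<^sup>*"
      by (intro rtrancl_mono adj_rel_mono) auto
    have g: "?g (?cl T x) = ?cl ?T x" for x
      using sub by (auto intro: rtrancl_trans)
    have img: "?cl ?T ` A = ?g ` (?cl T ` A)"
      by (simp only: image_image g)
    have e: "(u, v) \<in> (adj_rel ends ?T)\<^sup>*"
      using uv by (auto simp: adj_rel_def)
    have "?cl ?T u = ?cl ?T v"
      using e rtrancl_adj_rel_sym[OF e] by (auto intro: rtrancl_trans)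
    then have "?g (?cl T u) = ?g (?cl T v)" by (simp only: g)
    moreover have "?cl T u \<noteq> ?cl T v" using False by auto
    ultimately have "\<not> inj_on ?g (?cl T ` A)"
      using imageI[OF uv(1), of "?cl T"] imageI[OF uv(2), of "?cl T"] by (meson inj_onD)
    then have "card (?cl ?T ` A) < card (?cl T ` A)"
      unfolding img using \<open>finite A\<close>
      by (meson card_image_le eq_card_imp_inj_on finite_imageI le_neq_implies_less)
    moreover have "card ?T \<le> Suc (card T)" by (rule card_insert_le_m1) auto
    moreover have "adj_rel ends (insert e B) \<subseteq> (adj_rel ends ?T)\<^sup>*"
    proof -
      have "adj_rel ends (insert e B) \<subseteq> adj_rel ends B \<union> adj_rel ends ?T"
        by (auto simp: adj_rel_def)
      then show ?thesis using T(3) sub by blast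
    qed
    ultimately show ?thesis
      using T(1,2) by (intro exI[of _ ?T]) auto
  qed
qed

lemma spanning_subset:
  assumes "finite B" "finite A" "A \<noteq> {}" "\<And>e. e \<in> B \<Longrightarrow> \<exists>u\<in>A. \<exists>v\<in>A. ends e = {u, v}"
  shows "\<exists>T\<subseteq>B. card T < card A \<and> adj_rel ends B \<subseteq> (adj_rel ends T)\<^sup>*"
proof -
  obtain T where T: "T \<subseteq> B" "card T + card ((\<lambda>v. (adj_rel ends T)\<^sup>* `` {v}) ` A) \<le> card A"
    "adj_rel ends B \<subseteq> (adj_rel ends T)\<^sup>*"
    using spanning_subset_component_count[OF assms(1,2), of ends] assms(4) by meson
  moreover have "card ((\<lambda>v. (adj_rel ends T)\<^sup>* `` {v}) ` A) > 0"
    using assms(2,3) by (simp add: card_gt_0_iff)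
  ultimately show ?thesis by (intro exI[of _ T]) auto
qed

text \<open>Steps are prepended; if the new start already lies on the path, the path is cut back to
  that node instead. Appending one closing edge to \<open>es\<close> gives the format of
  \<open>is_cycle\<close>.\<close>

lemma rtrancl_adj_rel_simple_path:
  assumes "(u, v) \<in> (adj_rel ends T)\<^sup>*"
  shows "\<exists>vs es. length vs = Suc (length es) \<and> vs ! 0 = u \<and> vs ! length es = v \<and> distinct vs \<and>
    distinct es \<and> set es \<subseteq> T \<and> (\<forall>i < length es. ends (es ! i) = {vs ! i, vs ! Suc i})"
  using assms
proof (induction rule: converse_rtrancl_induct)
  case base
  show ?case by (rule exI[of _ "[v]"], rule exI[of _ "[]"]) auto
next
  case (step x w)
  obtain vs es where p: "length vs = Suc (length es)" "vs ! 0 = w" "vs ! length es = v"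
    "distinct vs" "distinct es" "set es \<subseteq> T"
    "\<And>i. i < length es \<Longrightarrow> ends (es ! i) = {vs ! i, vs ! Suc i}"
    using step.IH by blast
  obtain e where e: "e \<in> T" "ends e = {x, w}"
    using step.hyps by (auto simp: adj_rel_def)
  show ?case
  proof (cases "x \<in> set vs")
    case True
    then obtain k where k: "k < length vs" "vs ! k = x" by (auto simp: in_set_conv_nth)
    show ?thesis
      using k p set_drop_subset[of k es]
      by (intro exI[of _ "drop k vs"] exI[of _ "drop k es"]) auto
  next
    case False
    have "e \<notin> set es"
    proof
      assume "e \<in> set es"
      then obtain i where i: "i < length es" "es ! i = e" by (auto simp: in_set_conv_nth)
      then have "x \<in> {vs ! i, vs ! Suc i}" using p(7)[of i] e by auto
      moreover have "vs ! i \<in> set vs" "vs ! Suc i \<in> set vs" using i p(1) by auto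
      ultimately show False using False by auto
    qed
    then show ?thesis
      using p e False
      by (intro exI[of _ "x # vs"] exI[of _ "e # es"]) (auto simp: nth_Cons split: nat.splits)
  qed
qed

text \<open>An edge outside a spanning subset \<open>T\<close> would close a cycle with a simple
  path of \<open>T\<close> between its ends; for a loop that path has no edges.\<close>

lemma forest_card_less:
  assumes "forest ends B" "finite B" "finite A" "A \<noteq> {}"
    and "\<And>e. e \<in> B \<Longrightarrow> \<exists>u\<in>A. \<exists>v\<in>A. ends e = {u, v}"
  shows "card B < card A"
proof -
  obtain T where T: "T \<subseteq> B" "card T < card A" "adj_rel ends B \<subseteq> (adj_rel ends T)\<^sup>*"
    using spanning_subset[OF assms(2-4), of ends] assms(5) by meson
  have "B \<subseteq> T"
  proof (rule ccontr)
    assume "\<not> B \<subseteq> T"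
    then obtain e where e: "e \<in> B" "e \<notin> T" by blast
    obtain u v where uv: "ends e = {u, v}" using assms(5)[OF e(1)] by blast
    then have "(u, v) \<in> adj_rel ends B" using e by (auto simp: adj_rel_def)
    then have "(u, v) \<in> (adj_rel ends T)\<^sup>*" using T(3) by blast
    from rtrancl_adj_rel_simple_path[OF this]
    obtain vs es where p: "length vs = Suc (length es)" "vs ! 0 = u" "vs ! length es = v"
      "distinct vs" "distinct es" "set es \<subseteq> T"
      "\<And>i. i < length es \<Longrightarrow> ends (es ! i) = {vs ! i, vs ! Suc i}"
      by blast
    have "is_cycle ends B vs (es @ [e])"
      unfolding is_cycle_def
    proof (intro conjI allI impI)
      fix i assume "i < length (es @ [e])"
      then consider "i < length es" | "i = length es" by fastforce
      then show "ends ((es @ [e]) ! i) = {vs ! i, vs ! (Suc i mod length (es @ [e]))}"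
        by cases (use p uv in \<open>auto simp: nth_append insert_commute\<close>)
    qed (use p e T(1) in auto)
    then show False using assms(1) by (auto simp: forest_def)
  qed
  then show ?thesis using T by (metis subset_antisym)
qed

lemma forest_subset: "forest ends B \<Longrightarrow> C \<subseteq> B \<Longrightarrow> forest ends C"
  unfolding forest_def is_cycle_def by (meson subset_trans)

lemma edge_degree_eq_sum:
  "finite B \<Longrightarrow> edge_degree ends B v = (\<Sum>e\<in>B. if v \<in> ends e then 1 else 0)"
  unfolding edge_degree_def incident_edges_def by (simp flip: sum.inter_filter)

text \<open>Double counting of incidences. Since \<open>ends e\<close> is a set, a loop counts once
  on both sides.\<close>

lemma sum_edge_degree:
  assumes "finite A" "finite B"
  shows "(\<Sum>v\<in>A. edge_degree ends B v) = (\<Sum>e\<in>B. card (ends e \<inter> A))"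
proof -
  have "card (ends e \<inter> A) = (\<Sum>v\<in>A. if v \<in> ends e then 1 else 0)" for e
    using assms(1) by (simp add: Int_def conj_commute flip: sum.inter_filter)
  then show ?thesis by (simp add: edge_degree_eq_sum[OF assms(2)] sum.swap[of _ A])
qed

section \<open>Two-edge cuts\<close>

lemma doubleton_split:
  assumes "A = {x, y}" "P x \<noteq> P y"
  obtains a b where "A = {a, b}" "P a" "\<not> P b"
  using assms by (cases "P x") (auto simp: insert_commute)

definition edge_cut :: "('e \<Rightarrow> 'v set) \<Rightarrow> 'e set \<Rightarrow> 'v set \<Rightarrow> 'e set" where
  "edge_cut ends H S = {e \<in> H. ends e \<inter> S \<noteq> {} \<and> \<not> ends e \<subseteq> S}"

lemma edge_cut_subset: "edge_cut ends H S \<subseteq> H"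
  by (auto simp: edge_cut_def)

lemma mem_edge_cut:
  "e \<in> H \<Longrightarrow> ends e = {u, v} \<Longrightarrow> e \<in> edge_cut ends H S \<longleftrightarrow> (u \<in> S) \<noteq> (v \<in> S)"
  by (auto simp: edge_cut_def)

locale two_edge_connected_multigraph =
  fixes V :: "'v set" and H :: "'e set" and ends :: "'e \<Rightarrow> 'v set"
  assumes multigraph: "multigraph V H ends"
    and two_edge_connected: "two_edge_connected ends V H"
begin

lemma finite_nodes: "finite V" and finite_edges: "finite H"
  using multigraph by (auto simp: multigraph_def)

lemma edge_ends:
  assumes "e \<in> H"
  obtains u v where "u \<in> V" "v \<in> V" "ends e = {u, v}"
  using multigraph assms by (auto simp: multigraph_def)

lemma ends_subset: "e \<in> H \<Longrightarrow> ends e \<subseteq> V"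
  using multigraph by (auto simp: multigraph_def)

text \<open>An edge crosses a set iff membership differs at its two ends, and this parity adds under
  symmetric difference.\<close>

lemma edge_cut_sym_diff:
  "edge_cut ends H ((S - S') \<union> (S' - S)) =
    (edge_cut ends H S - edge_cut ends H S') \<union> (edge_cut ends H S' - edge_cut ends H S)"
proof (rule set_eqI)
  fix e
  show "e \<in> edge_cut ends H ((S - S') \<union> (S' - S)) \<longleftrightarrow>
    e \<in> (edge_cut ends H S - edge_cut ends H S') \<union> (edge_cut ends H S' - edge_cut ends H S)"
  proof (cases "e \<in> H")
    case True
    then obtain u v where "ends e = {u, v}" by (rule edge_ends)
    with True show ?thesis by (auto simp: mem_edge_cut)
  qed (auto simp: edge_cut_def)
qed

text \<open>The form in which 2-edge-connectedness is used: after deletion of \<open>e\<close>, a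
  walk from \<open>S\<close> to its complement still exists and crosses.\<close>

lemma edge_cut_not_subset_singleton:
  assumes "S \<subseteq> V" "S \<noteq> {}" "S \<noteq> V"
  shows "\<not> edge_cut ends H S \<subseteq> {e}"
proof
  assume sub: "edge_cut ends H S \<subseteq> {e}"
  obtain x y where xy: "x \<in> S" "y \<in> V" "y \<notin> S" using assms by blast
  have "connected_graph ends V (H - {e})"
    using two_edge_connected by (cases "e \<in> H") (auto simp: two_edge_connected_def)
  then have "(x, y) \<in> (adj_rel ends (H - {e}))\<^sup>*"
    using xy assms(1) by (auto simp: connected_graph_def)
  from rtrancl_adj_rel_crossing[OF this, of "\<lambda>z. z \<in> S"] xy
  obtain t a b where "t \<in> H - {e}" "ends t = {a, b}" "a \<in> S" "b \<notin> S" by blast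
  then show False using sub mem_edge_cut[of t H ends a b S] by blast
qed

lemma edge_cut_empty: "S \<subseteq> V \<Longrightarrow> edge_cut ends H S = {} \<Longrightarrow> S = {} \<or> S = V"
  using edge_cut_not_subset_singleton by (metis empty_subsetI)

definition mate :: "'e \<Rightarrow> 'e \<Rightarrow> bool" where
  "mate e f \<longleftrightarrow> e \<noteq> f \<and> (\<exists>S\<subseteq>V. edge_cut ends H S = {e, f})"

lemma mate_sym: "mate e f \<Longrightarrow> mate f e"
  unfolding mate_def by (metis insert_commute)

text \<open>The common edge \<open>f\<close> cancels in the symmetric difference of the two
  cuts.\<close>

lemma mate_trans:
  assumes "mate e f" "mate f g" "e \<noteq> g"
  shows "mate e g"
proof -
  obtain S S' where S: "S \<subseteq> V" "edge_cut ends H S = {e, f}" "S' \<subseteq> V" "edge_cut ends H S' = {f, g}"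
    using assms by (auto simp: mate_def)
  then have "edge_cut ends H ((S - S') \<union> (S' - S)) = {e, g}"
    using assms by (auto simp: edge_cut_sym_diff mate_def)
  moreover have "(S - S') \<union> (S' - S) \<subseteq> V" using S by auto
  ultimately show ?thesis using assms(3) unfolding mate_def by blast
qed

lemma mate_edges: "mate e f \<Longrightarrow> e \<in> H \<and> f \<in> H"
  by (auto simp: mate_def edge_cut_def)

text \<open>Deleting \<open>e\<close> keeps the graph connected, so some further edge
  \<open>f\<close> must disconnect it. A component of what remains has its cut inside
  \<open>{e, f}\<close>, and no cut has fewer than two edges.\<close>

lemma essential_has_mate:
  assumes "essential ends V H e"
  shows "\<exists>f. mate e f"
proof -
  have e: "e \<in> H" "\<not> two_edge_connected ends V (H - {e})"
    using assms by (auto simp: essential_def)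
  moreover have "connected_graph ends V (H - {e})"
    using two_edge_connected e by (auto simp: two_edge_connected_def)
  ultimately obtain f where f: "f \<in> H - {e}" "\<not> connected_graph ends V (H - {e} - {f})"
    by (auto simp: two_edge_connected_def)
  let ?A = "adj_rel ends (H - {e} - {f})"
  obtain u v where uv: "u \<in> V" "v \<in> V" "(u, v) \<notin> ?A\<^sup>*"
    using f by (auto simp: connected_graph_def)
  define S where "S = ?A\<^sup>* `` {u} \<inter> V"
  have S: "S \<subseteq> V" "S \<noteq> {}" "S \<noteq> V" using uv by (auto simp: S_def)
  have "edge_cut ends H S \<subseteq> {e, f}"
  proof
    fix g assume g: "g \<in> edge_cut ends H S"
    then have "g \<in> H" by (auto simp: edge_cut_def)
    then obtain a b where ab: "a \<in> V" "b \<in> V" "ends g = {a, b}" by (rule edge_ends)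
    show "g \<in> {e, f}"
    proof (rule ccontr)
      assume "g \<notin> {e, f}"
      then have "(a, b) \<in> ?A" "(b, a) \<in> ?A"
        using ab \<open>g \<in> H\<close> by (auto simp: adj_rel_def insert_commute)
      then have "a \<in> S \<longleftrightarrow> b \<in> S"
        using ab by (auto simp: S_def intro: rtrancl_into_rtrancl)
      then show False using g mem_edge_cut[where ends = ends, OF \<open>g \<in> H\<close> ab(3)] by auto
    qed
  qed
  moreover have "\<not> edge_cut ends H S \<subseteq> {e}" "\<not> edge_cut ends H S \<subseteq> {f}"
    using edge_cut_not_subset_singleton[OF S] by auto
  ultimately have "edge_cut ends H S = {e, f}" by blast
  moreover have "e \<noteq> f" using f(1) by blast
  ultimately show ?thesis using S(1) unfolding mate_def by blast
qed

end

section \<open>Contraction to a cactus\<close>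

locale essential_outside_forest = two_edge_connected_multigraph +
  fixes F
  assumes F_sub: "F \<subseteq> H" and forest: "forest ends F"
    and essential: "\<And>e. e \<in> H - F \<Longrightarrow> essential ends V H e"
begin

definition D where "D = H - F"

definition D1 where "D1 = {e \<in> D. \<forall>f. mate e f \<longrightarrow> f \<in> F}"

definition partner where "partner e = (SOME f. mate e f)"

definition R where "R = D \<union> partner ` D1"

definition K where "K = {S. S \<subseteq> V \<and> edge_cut ends H S \<subseteq> R \<and> card (edge_cut ends H S) = 2}"

text \<open>A quotient node is encoded as the set of cut sides in \<open>K\<close> containing the
  original node. Nodes of \<open>V\<close> are identified iff no cut of \<open>K\<close> separates
  them, and the side of a class with respect to \<open>S\<close> is read off as membership of
  \<open>S\<close>.\<close>

definition cls where "cls v = {S \<in> K. v \<in> S}"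

text \<open>The quotient keeps the edge names; an edge inside one class becomes a loop.\<close>

definition cends where "cends e = cls ` ends e"

lemma finite_F: "finite F"
  using F_sub finite_edges by (rule finite_subset)

lemma finite_D: "finite D"
  unfolding D_def using finite_edges by simp

lemma D1_sub: "D1 \<subseteq> D"
  by (auto simp: D1_def)

lemma finite_R: "finite R"
  unfolding R_def using finite_D finite_subset[OF D1_sub finite_D] by simp

lemma mate_partner: "e \<in> D1 \<Longrightarrow> mate e (partner e)"
  using essential_has_mate[OF essential] unfolding partner_def D1_def D_def
  by (auto intro: someI_ex)

lemma partner_F: "e \<in> D1 \<Longrightarrow> partner e \<in> F"
  using mate_partner by (auto simp: D1_def)

lemma R_sub: "R \<subseteq> H"
  using partner_F F_sub by (auto simp: R_def D_def)

text \<open>The mate \<open>r\<close> lies in \<open>F\<close>, hence is the partner of some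
  \<open>e'\<close> in \<open>D1\<close>. If \<open>e'\<close> differed from \<open>e\<close>,
  transitivity through \<open>r\<close> would give \<open>e\<close> a mate outside
  \<open>F\<close>.\<close>

lemma mate_in_R_unique:
  assumes "e \<in> D1" "mate e r" "r \<in> R"
  shows "r = partner e"
proof -
  have "r \<in> F" using assms by (auto simp: D1_def)
  then obtain e' where e': "e' \<in> D1" "r = partner e'"
    using assms(3) by (auto simp: R_def D_def)
  have "e' = e"
  proof (rule ccontr)
    assume "e' \<noteq> e"
    moreover have "mate r e'" using mate_partner e' mate_sym by auto
    ultimately have "mate e e'" using mate_trans assms(2) by blast
    then show False using assms(1) e'(1) by (auto simp: D1_def D_def)
  qed
  then show ?thesis using e' by simp
qed

lemma inj_partner: "inj_on partner D1"
proof (rule inj_onI, rule ccontr)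
  fix e e' assume e: "e \<in> D1" "e' \<in> D1" "partner e = partner e'" "e \<noteq> e'"
  then have "mate e e'"
    using mate_trans mate_partner mate_sym by metis
  then show False using e by (auto simp: D1_def D_def)
qed

lemma card_R: "card R = card D + card D1"
proof -
  have "D \<inter> partner ` D1 = {}" using partner_F by (auto simp: D_def)
  then show ?thesis
    unfolding R_def using finite_D finite_subset[OF D1_sub finite_D] inj_partner
    by (subst card_Un_disjoint) (auto simp: card_image)
qed

lemma mate_in_K:
  assumes "mate e f" "e \<in> R" "f \<in> R"
  obtains S where "S \<in> K" "edge_cut ends H S = {e, f}"
  using assms by (auto simp: mate_def K_def)

text \<open>Every edge of \<open>R\<close> has a mate inside \<open>R\<close>: its partner for
  \<open>D1\<close>, a mate outside \<open>F\<close> for the rest of \<open>D\<close>, and the edge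
  of \<open>D1\<close> itself for a partner.\<close>

lemma R_crosses_K:
  assumes "r \<in> R"
  obtains S where "S \<in> K" "r \<in> edge_cut ends H S"
proof -
  have "\<exists>f\<in>R. mate r f"
  proof (cases "r \<in> D")
    case True
    show ?thesis
    proof (cases "r \<in> D1")
      case True
      then show ?thesis using mate_partner by (auto simp: R_def)
    next
      case False
      then obtain f where "mate r f" "f \<notin> F" using True by (auto simp: D1_def)
      then show ?thesis using mate_edges by (auto simp: R_def D_def)
    qed
  next
    case False
    then obtain e where "e \<in> D1" "r = partner e" using assms by (auto simp: R_def)
    then have "mate r e" "e \<in> R" using mate_partner mate_sym D1_sub by (auto simp: R_def)
    then show ?thesis by blast
  qed
  then show ?thesis using that assms mate_in_K by (metis insertI1)
qed

lemma mem_edge_cut_cends: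
  assumes "S \<in> K" "r \<in> H" "cends r = {x, y}"
  shows "r \<in> edge_cut ends H S \<longleftrightarrow> (S \<in> x) \<noteq> (S \<in> y)"
proof -
  obtain u v where uv: "ends r = {u, v}" using edge_ends assms(2) by blast
  then have "{x, y} = {cls u, cls v}" using assms(3) by (simp add: cends_def)
  moreover have "S \<in> cls z \<longleftrightarrow> z \<in> S" for z using assms(1) by (auto simp: cls_def)
  ultimately show ?thesis
    using mem_edge_cut[where ends = ends, OF assms(2) uv] by (auto simp: doubleton_eq_iff)
qed

text \<open>An edge of \<open>R\<close> crosses some cut of \<open>K\<close>, so its ends get
  different classes; all cuts of \<open>K\<close> consist of edges of \<open>R\<close>, so any other
  edge becomes a loop.\<close>

lemma card_cends:
  assumes "e \<in> H"
  shows "card (cends e) = (if e \<in> R then 2 else 1)"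
proof -
  obtain u v where uv: "ends e = {u, v}" using edge_ends assms by blast
  then have c: "cends e = {cls u, cls v}" by (simp add: cends_def)
  show ?thesis
  proof (cases "e \<in> R")
    case True
    then obtain S where "S \<in> K" "e \<in> edge_cut ends H S" by (rule R_crosses_K)
    then have "cls u \<noteq> cls v" using mem_edge_cut_cends[OF _ assms c] by auto
    then show ?thesis using c True by simp
  next
    case False
    have "S \<in> cls u \<longleftrightarrow> S \<in> cls v" for S
    proof (cases "S \<in> K")
      case True
      then have "e \<notin> edge_cut ends H S" using False by (auto simp: K_def)
      then show ?thesis using mem_edge_cut_cends[OF True assms c] by auto
    qed (auto simp: cls_def)
    then have "cls u = cls v" by blast
    then show ?thesis using c False by simp
  qed
qed

lemma cends_edge: "e \<in> H \<Longrightarrow> \<exists>x\<in>cls ` V. \<exists>y\<in>cls ` V. cends e = {x, y}"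
  by (erule edge_ends) (auto simp: cends_def)

text \<open>
  An edge outside two edge-disjoint spanning forests of the quotient has its ends joined by two
  further edge-disjoint paths, so it lies in no two-edge cut.
\<close>

lemma card_R_le:
  assumes "V \<noteq> {}"
  shows "card R + 2 \<le> 2 * card (cls ` V)"
proof -
  have fin: "finite (cls ` V)" and ne: "cls ` V \<noteq> {}" using finite_nodes assms by auto
  have edges: "\<exists>u\<in>cls ` V. \<exists>v\<in>cls ` V. cends e = {u, v}" if "e \<in> R" for e
    using cends_edge that R_sub by auto
  obtain T where T: "T \<subseteq> R" "card T < card (cls ` V)" "adj_rel cends R \<subseteq> (adj_rel cends T)\<^sup>*"
    using spanning_subset[OF finite_R fin ne, of cends] edges by meson
  have finRT: "finite (R - T)" using finite_R by auto
  obtain U where U: "U \<subseteq> R - T" "card U < card (cls ` V)"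
      "adj_rel cends (R - T) \<subseteq> (adj_rel cends U)\<^sup>*"
    using spanning_subset[OF finRT fin ne, of cends] edges by (meson DiffD1)
  have "R \<subseteq> T \<union> U"
  proof
    fix e assume e: "e \<in> R"
    show "e \<in> T \<union> U"
    proof (rule ccontr)
      assume n: "e \<notin> T \<union> U"
      obtain S where S: "S \<in> K" "e \<in> edge_cut ends H S" using e by (rule R_crosses_K)
      obtain x y where xy: "cends e = {x, y}" using edges[OF e] by meson
      have "(S \<in> x) \<noteq> (S \<in> y)" using mem_edge_cut_cends[OF S(1) _ xy] S(2) e R_sub by auto
      then obtain x y where xy: "cends e = {x, y}" "S \<in> x" "S \<notin> y"
        by (rule doubleton_split[OF xy])
      have "(x, y) \<in> (adj_rel cends T)\<^sup>*" "(x, y) \<in> (adj_rel cends U)\<^sup>*"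
      proof -
        have "(x, y) \<in> adj_rel cends R" "(x, y) \<in> adj_rel cends (R - T)"
          using e n by (auto intro: adj_relI[of e, where ends = cends, OF _ xy(1)])
        then show "(x, y) \<in> (adj_rel cends T)\<^sup>*" "(x, y) \<in> (adj_rel cends U)\<^sup>*"
          using T(3) U(3) by blast+
      qed
      moreover have "\<exists>t\<in>Z. t \<in> edge_cut ends H S" if xy_conn: "(x, y) \<in> (adj_rel cends Z)\<^sup>*" and ZR: "Z \<subseteq> R" for Z
      proof -
        obtain t a b where t: "t \<in> Z" "cends t = {a, b}" "S \<in> a" "S \<notin> b"
          using rtrancl_adj_rel_crossing[OF xy_conn, of "\<lambda>z. S \<in> z"] xy(2,3) by meson
        then have "t \<in> H" using ZR R_sub by blast
        then show ?thesis using mem_edge_cut_cends[OF S(1) _ t(2)] t by auto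
      qed
      ultimately obtain t t' where t: "t \<in> T" "t \<in> edge_cut ends H S"
        and t': "t' \<in> U" "t' \<in> edge_cut ends H S"
        using T(1) U(1) by (meson Diff_subset subset_trans)
      have "card {e, t, t'} \<le> card (edge_cut ends H S)"
        using S(2) t t' finite_edges by (intro card_mono) (auto simp: edge_cut_def)
      moreover have "card {e, t, t'} = 3" using n t t' U(1) by (auto simp: card_insert_if)
      moreover have "card (edge_cut ends H S) = 2" using S(1) by (simp add: K_def)
      ultimately show False by simp
    qed
  qed
  then have "card R \<le> card (T \<union> U)"
    using T U finite_R by (intro card_mono) (auto intro: finite_subset)
  also have "\<dots> \<le> card T + card U" by (rule card_Un_le)
  finally show ?thesis using T(2) U(2) by simp
qed

text \<open>
  If a cut \<open>S\<close> inside \<open>R\<close> separated the two edges of the cut \<open>S0\<close>, uncrossing the two cuts would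
  give \<open>e\<close> a second mate in \<open>R\<close>.
\<close>

lemma cends_partner:
  assumes e: "e \<in> D1"
  shows "cends (partner e) = cends e"
proof -
  let ?f = "partner e"
  have eH: "e \<in> H" and fH: "?f \<in> H" using mate_edges mate_partner[OF e] by auto
  obtain u0 v0 where uv0: "ends e = {u0, v0}" using edge_ends eH by blast
  obtain a0 b0 where ab0: "ends ?f = {a0, b0}" using edge_ends fH by blast
  have "e \<in> R" "?f \<in> R" using e D1_sub by (auto simp: R_def)
  then obtain S0 where S0: "S0 \<in> K" "edge_cut ends H S0 = {e, ?f}"
    using mate_in_K[OF mate_partner[OF e]] by blast
  have "(u0 \<in> S0) \<noteq> (v0 \<in> S0)" "(a0 \<in> S0) \<noteq> (b0 \<in> S0)"
    using S0 mem_edge_cut[where ends = ends, OF eH uv0] mem_edge_cut[where ends = ends, OF fH ab0] by auto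
  then obtain u v a b where uv: "ends e = {u, v}" "u \<in> S0" "v \<notin> S0"
    and ab: "ends ?f = {a, b}" "a \<in> S0" "b \<notin> S0"
    using doubleton_split[OF uv0, of "\<lambda>x. x \<in> S0"] doubleton_split[OF ab0, of "\<lambda>x. x \<in> S0"]
    by metis
  have uvV: "{u, v, a, b} \<subseteq> V"
    using ends_subset[OF eH] ends_subset[OF fH] uv ab by auto
  \<comment> \<open>Parallelism in the quotient follows once every cut of \<open>K\<close> leaves
    \<open>u\<close> with \<open>a\<close> and \<open>v\<close> with \<open>b\<close>.\<close>
  have same: "(u \<in> S \<longleftrightarrow> a \<in> S) \<and> (v \<in> S \<longleftrightarrow> b \<in> S)" if S: "S \<in> K" for S
  proof -
    obtain g h where gh: "edge_cut ends H S = {g, h}" "g \<noteq> h"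
      using S by (auto simp: K_def card_2_iff)
    have SV: "S \<subseteq> V" "S0 \<subseteq> V" and ghR: "g \<in> R" "h \<in> R" using S S0 gh by (auto simp: K_def)
    have mgh: "mate g h" using gh SV by (auto simp: mate_def)
    show ?thesis
    proof (cases "e \<in> {g, h} \<or> ?f \<in> {g, h}")
      case True
      have uniq: "r = ?f" if "e \<noteq> r" "mate ?f r \<or> mate e r" "r \<in> R" for r
        using mate_in_R_unique[OF e] mate_trans[OF mate_partner[OF e]] that by blast
      have "edge_cut ends H S = {e, ?f}"
      proof -
        consider "e = g" | "e = h" | "?f = g" | "?f = h" using True by blast
        then have "?f = h \<and> e = g \<or> ?f = g \<and> e = h"
        proof cases
          case 1
          then show ?thesis using uniq[of h] mgh gh(2) ghR by auto
        next
          case 2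
          then show ?thesis using uniq[of g] mate_sym[OF mgh] gh(2) ghR by auto
        next
          case 3
          then show ?thesis using uniq[of h] mgh gh(2) ghR by auto
        next
          case 4
          then show ?thesis using uniq[of g] mate_sym[OF mgh] gh(2) ghR by auto
        qed
        then show ?thesis using gh(1) by blast
      qed
      \<comment> \<open>\<open>S\<close> and \<open>S0\<close> have the same cut, so
        \<open>S\<close> is \<open>S0\<close> or its complement.\<close>
      then have "edge_cut ends H ((S - S0) \<union> (S0 - S)) = {}"
        using S0 by (simp add: edge_cut_sym_diff)
      then have "(S - S0) \<union> (S0 - S) = {} \<or> (S - S0) \<union> (S0 - S) = V"
        using edge_cut_empty[of "(S - S0) \<union> (S0 - S)"] SV by auto
      then show ?thesis using uv ab uvV by blast
    next
      case False
      have uS: "u \<in> S \<longleftrightarrow> v \<in> S" and aS: "a \<in> S \<longleftrightarrow> b \<in> S"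
        using False gh(1) mem_edge_cut[where ends = ends, OF eH uv(1)] mem_edge_cut[where ends = ends, OF fH ab(1)]
        by auto
      have no_mate: "\<not> mate e g" "\<not> mate e h"
        using False mate_in_R_unique[OF e] ghR by auto
      have "u \<in> S \<longleftrightarrow> a \<in> S"
      proof (rule ccontr)
        assume ne: "(u \<in> S) \<noteq> (a \<in> S)"
        \<comment> \<open>Complementing if necessary, \<open>S'\<close> contains both ends of
          \<open>e\<close> and neither end of the partner.\<close>
        define S' where "S' = (if u \<in> S then S else V - S)"
        have cS': "edge_cut ends H S' = {g, h}"
        proof -
          have "edge_cut ends H (V - S) = edge_cut ends H S"
            using ends_subset unfolding edge_cut_def by blast
          then show ?thesis using gh by (simp add: S'_def)
        qed
        have S': "S' \<subseteq> V" "u \<in> S'" "v \<in> S'" "a \<notin> S'" "b \<notin> S'"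
          using ne uS aS uvV SV by (auto simp: S'_def)
        \<comment> \<open>\<open>?X\<close> contains \<open>u\<close> but not \<open>v\<close>, and
          \<open>?Y\<close> contains \<open>v\<close> but not \<open>u\<close>, so each has a cut
          with at least two edges. Only \<open>e\<close>, \<open>g\<close>, \<open>h\<close> can
          occur in these cuts, and only \<open>e\<close> in both.\<close>
        let ?X = "S0 \<inter> S'" and ?Y = "S' - S0"
        have X: "\<not> edge_cut ends H ?X \<subseteq> {r}" for r
          using edge_cut_not_subset_singleton[of ?X r] S' uv uvV SV by blast
        have Y: "\<not> edge_cut ends H ?Y \<subseteq> {r}" for r
          using edge_cut_not_subset_singleton[of ?Y r] S' uv uvV SV by blast
        have XY: "t \<in> edge_cut ends H ?X \<longrightarrow> t \<in> {e, g, h}" "t \<in> edge_cut ends H ?Y \<longrightarrow> t \<in> {e, g, h}"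
          "t \<in> edge_cut ends H ?X \<longrightarrow> t \<in> edge_cut ends H ?Y \<longrightarrow> t = e" if tH: "t \<in> H" for t
        proof -
          obtain p q where pq: "ends t = {p, q}" using edge_ends tH by blast
          have m: "(t \<in> edge_cut ends H Z) \<longleftrightarrow> (p \<in> Z) \<noteq> (q \<in> Z)" for Z
            using mem_edge_cut[where ends = ends, OF tH pq] .
          have f1: "((p \<in> S0) \<noteq> (q \<in> S0)) = (t = e \<or> t = ?f)" using m[of S0] S0 by auto
          have f2: "((p \<in> S') \<noteq> (q \<in> S')) = (t = g \<or> t = h)" using m[of S'] cS' by auto
          have f3: "t = ?f \<Longrightarrow> p \<notin> S' \<and> q \<notin> S'" using pq ab S' by (auto simp: doubleton_eq_iff)
          show "t \<in> edge_cut ends H ?X \<longrightarrow> t \<in> {e, g, h}" "t \<in> edge_cut ends H ?Y \<longrightarrow> t \<in> {e, g, h}"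
            "t \<in> edge_cut ends H ?X \<longrightarrow> t \<in> edge_cut ends H ?Y \<longrightarrow> t = e"
            unfolding m using f1 f2 f3 False by auto
        qed
        have sub: "edge_cut ends H ?X \<subseteq> {e, g, h}" "edge_cut ends H ?Y \<subseteq> {e, g, h}"
          "edge_cut ends H ?X \<inter> edge_cut ends H ?Y \<subseteq> {e}"
          using XY by (auto dest: subsetD[OF edge_cut_subset])
        \<comment> \<open>Each of the two cuts needs an edge besides \<open>e\<close>, so
          \<open>?X\<close> cannot take both \<open>g\<close> and \<open>h\<close>.\<close>
        have "edge_cut ends H ?X = {e, g} \<or> edge_cut ends H ?X = {e, h}"
        proof -
          have "\<not> (g \<in> edge_cut ends H ?X \<and> h \<in> edge_cut ends H ?X)"
            using sub(2,3) Y[of e] False by blast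
          moreover have "g \<in> edge_cut ends H ?X \<or> h \<in> edge_cut ends H ?X"
            using sub(1) X[of e] by blast
          ultimately show ?thesis using sub(1) X[of g] X[of h] by blast
        qed
        then have "mate e g \<or> mate e h"
          using False le_infI1[OF SV(2), of S'] unfolding mate_def by blast
        then show False using no_mate by blast
      qed
      then show ?thesis using uS aS by blast
    qed
  qed
  have "cls u = cls a" "cls v = cls b" using same by (auto simp: cls_def)
  then show ?thesis using uv ab by (simp add: cends_def)
qed


section \<open>Degree counting in the quotient\<close>

lemma F_Int_R: "F \<inter> R = partner ` D1"
  using partner_F by (auto simp: R_def D_def)

lemma edge_degree_cends_partner: "edge_degree cends (F \<inter> R) c = edge_degree cends D1 c"
proof -
  have "incident_edges cends (F \<inter> R) c = partner ` incident_edges cends D1 c"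
    unfolding F_Int_R by (auto simp: incident_edges_def cends_partner)
  moreover have "inj_on partner (incident_edges cends D1 c)"
    using inj_partner by (rule inj_on_subset) (auto simp: incident_edges_def)
  ultimately show ?thesis by (simp add: edge_degree_def card_image)
qed

lemma sum_edge_degree_cends:
  assumes "B \<subseteq> R"
  shows "(\<Sum>c\<in>cls ` V. edge_degree cends B c) = 2 * card B"
proof -
  have fin: "finite (cls ` V)" "finite B"
    using finite_nodes finite_R assms finite_subset by auto
  have "card (cends e \<inter> cls ` V) = 2" if "e \<in> B" for e
  proof -
    have e: "e \<in> H" "e \<in> R" using that assms R_sub by auto
    then have "cends e \<inter> cls ` V = cends e" using ends_subset by (auto simp: cends_def)
    then show ?thesis using card_cends e by simp
  qed
  then show ?thesis using sum_edge_degree[OF fin] by simp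
qed

lemma card_ends_Int_class:
  assumes "e \<in> R"
  shows "card (ends e \<inter> {v \<in> V. cls v = c}) \<le> (if c \<in> cends e then 1 else 0)"
proof -
  have e: "e \<in> H" using assms R_sub by auto
  obtain u v where uv: "ends e = {u, v}" using edge_ends e by blast
  then have "cls u \<noteq> cls v" using card_cends[OF e] assms by (auto simp: cends_def)
  then have "ends e \<inter> {v \<in> V. cls v = c} \<subseteq> {if cls u = c then u else v}" using uv by auto
  then have "card (ends e \<inter> {v \<in> V. cls v = c}) \<le> card {if cls u = c then u else v}"
    by (intro card_mono) auto
  moreover have "ends e \<inter> {v \<in> V. cls v = c} = {}" if "c \<notin> cends e"
    using that by (auto simp: cends_def)
  ultimately show ?thesis by auto
qed

text \<open>The ends of an edge of \<open>R\<close> lie in different classes, so each edge is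
  counted at most once on the left.\<close>

lemma sum_edge_degree_class:
  assumes "B \<subseteq> R"
  shows "(\<Sum>v | v \<in> V \<and> cls v = c. edge_degree ends B v) \<le> edge_degree cends B c"
proof -
  have fin: "finite {v \<in> V. cls v = c}" "finite B"
    using finite_nodes finite_R assms finite_subset by auto
  have "(\<Sum>e\<in>B. card (ends e \<inter> {v \<in> V. cls v = c})) \<le> (\<Sum>e\<in>B. if c \<in> cends e then 1 else 0)"
    using card_ends_Int_class assms by (intro sum_mono) blast
  then show ?thesis using sum_edge_degree[OF fin, of ends] by (simp add: edge_degree_eq_sum[OF fin(2)])
qed

text \<open>Forest edges outside \<open>R\<close> that meet the class lie inside it, so there are
  fewer of them than nodes in the class. The other forest edges meeting it are partners, counted by
  the parallel edges of \<open>D1\<close>.\<close>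

lemma class_deficiency:
  assumes "c \<in> cls ` V"
  shows "2 \<le> (\<Sum>v | v \<in> V \<and> cls v = c. 2 - edge_degree ends F v) + edge_degree cends D1 c"
proof -
  let ?X = "{v \<in> V. cls v = c}"
  let ?B = "{f \<in> F - R. c \<in> cends f}"
  have fin: "finite ?X" "finite (F \<inter> R)" "finite (F - R)" "finite ?B" and ne: "?X \<noteq> {}"
    using finite_nodes finite_F assms by auto
  have inside: "ends f \<subseteq> ?X" if f: "f \<in> ?B" for f
  proof -
    have fH: "f \<in> H" using f F_sub by auto
    then have "card (cends f) = 1" using card_cends f by auto
    then have "cends f = {c}" using f by (auto simp: card_1_singleton_iff)
    then show ?thesis using ends_subset[OF fH] by (auto simp: cends_def)
  qed
  have "card ?B < card ?X"
  proof (rule forest_card_less[OF forest_subset[OF forest] fin(4,1) ne])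
    fix f assume f: "f \<in> ?B"
    then have "f \<in> H" using F_sub by auto
    then obtain u v where uv: "ends f = {u, v}" by (rule edge_ends)
    moreover have "u \<in> ?X" "v \<in> ?X" using inside[OF f] unfolding uv by auto
    ultimately show "\<exists>u\<in>?X. \<exists>v\<in>?X. ends f = {u, v}" by meson
  qed auto
  moreover have "(\<Sum>v\<in>?X. edge_degree ends F v) \<le> 2 * card ?B + edge_degree cends D1 c"
  proof -
    have "card (ends f \<inter> ?X) \<le> (if c \<in> cends f then 2 else 0)" if f: "f \<in> F - R" for f
    proof (cases "c \<in> cends f")
      case True
      have "f \<in> H" using F_sub f by auto
      then obtain u v where uv: "ends f = {u, v}" by (rule edge_ends)
      have "card (ends f \<inter> ?X) \<le> card {u, v}" unfolding uv by (intro card_mono) auto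
      also have "\<dots> \<le> 2" by (simp add: card_insert_if)
      finally show ?thesis using True by simp
    next
      case False
      then have "ends f \<inter> ?X = {}" by (auto simp: cends_def)
      then show ?thesis by simp
    qed
    then have "(\<Sum>f\<in>F - R. card (ends f \<inter> ?X)) \<le> (\<Sum>f\<in>F - R. if c \<in> cends f then 2 else 0)"
      by (rule sum_mono)
    also have "\<dots> = 2 * card ?B" using fin(3) by (simp flip: sum.inter_filter)
    finally have "(\<Sum>f\<in>F - R. card (ends f \<inter> ?X)) \<le> 2 * card ?B" .
    moreover have "(\<Sum>f\<in>F \<inter> R. card (ends f \<inter> ?X)) \<le> edge_degree cends D1 c"
      using sum_edge_degree_class[of "F \<inter> R" c] sum_edge_degree[OF fin(1,2), of ends]
      by (simp add: edge_degree_cends_partner)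
    moreover have "(\<Sum>v\<in>?X. edge_degree ends F v) =
        (\<Sum>f\<in>F \<inter> R. card (ends f \<inter> ?X)) + (\<Sum>f\<in>F - R. card (ends f \<inter> ?X))"
      by (simp only: sum_edge_degree[OF fin(1) finite_F] sum.Int_Diff[OF finite_F, of _ R])
    ultimately show ?thesis by linarith
  qed
  \<comment> \<open>Subtraction is truncated: nodes of degree above 2 only add slack.\<close>
  moreover have "2 * card ?X \<le> (\<Sum>v\<in>?X. 2 - edge_degree ends F v) + (\<Sum>v\<in>?X. edge_degree ends F v)"
  proof -
    have "2 * card ?X = (\<Sum>v\<in>?X. 2)" by simp
    also have "\<dots> \<le> (\<Sum>v\<in>?X. (2 - edge_degree ends F v) + edge_degree ends F v)"
      by (rule sum_mono) simp
    finally show ?thesis by (simp only: sum.distrib)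
  qed
  ultimately show ?thesis by linarith
qed

lemma sum_degree_leaves_le:
  "(\<Sum>v | v \<in> V \<and> edge_degree ends F v < 2. edge_degree ends (H - F) v)
    \<le> 3 * (\<Sum>v\<in>V. 2 - edge_degree ends F v)"
proof (cases "V = {}")
  case False
  let ?L = "{v \<in> V. edge_degree ends F v < 2}"
  let ?W = "\<Sum>v\<in>V. 2 - edge_degree ends F v"
  let ?w = "\<lambda>c. \<Sum>v | v \<in> V \<and> cls v = c. 2 - edge_degree ends F v"
  let ?C = "cls ` V" and ?P = "cls ` ?L"
  have fin: "finite ?L" "finite ?C" "finite ?P" and PC: "?P \<subseteq> ?C" using finite_nodes by auto
  have DR: "D \<subseteq> R" "D1 \<subseteq> R" using D1_sub by (auto simp: R_def)
  have "(\<Sum>v\<in>?L. edge_degree ends D v)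
      = (\<Sum>c\<in>?P. \<Sum>v | v \<in> ?L \<and> cls v = c. edge_degree ends D v)"
    using fin(1) by (rule sum.image_gen)
  also have "\<dots> \<le> (\<Sum>c\<in>?P. edge_degree cends D c)"
  proof (rule sum_mono)
    fix c
    have "(\<Sum>v | v \<in> ?L \<and> cls v = c. edge_degree ends D v)
        \<le> (\<Sum>v | v \<in> V \<and> cls v = c. edge_degree ends D v)"
      using finite_nodes by (intro sum_mono2) auto
    then show "(\<Sum>v | v \<in> ?L \<and> cls v = c. edge_degree ends D v) \<le> edge_degree cends D c"
      using sum_edge_degree_class[OF DR(1), of c] by linarith
  qed
  finally have T: "(\<Sum>v\<in>?L. edge_degree ends D v) \<le> (\<Sum>c\<in>?P. edge_degree cends D c)" .
  have "2 \<le> edge_degree cends D c" if c: "c \<in> ?C - ?P" for c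
  proof -
    \<comment> \<open>All nodes of a class missing \<open>?L\<close> have deficiency 0, so
      \<open>D1\<close> alone must supply the degree 2.\<close>
    have "?w c = 0" using c by (intro sum.neutral) (auto simp: not_less)
    then have "2 \<le> edge_degree cends D1 c" using class_deficiency c by force
    also have "\<dots> \<le> edge_degree cends D c"
      unfolding edge_degree_def incident_edges_def
      using D1_sub finite_D by (intro card_mono) auto
    finally show ?thesis .
  qed
  then have "(\<Sum>c\<in>?C - ?P. 2) \<le> (\<Sum>c\<in>?C - ?P. edge_degree cends D c)" by (rule sum_mono)
  moreover have "(\<Sum>c\<in>?C. edge_degree cends D c)
      = (\<Sum>c\<in>?C - ?P. edge_degree cends D c) + (\<Sum>c\<in>?P. edge_degree cends D c)"
    using PC fin(2) by (rule sum.subset_diff)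
  moreover have "card (?C - ?P) = card ?C - card ?P" "card ?P \<le> card ?C"
    using PC fin by (auto intro: card_Diff_subset card_mono)
  ultimately have "(\<Sum>c\<in>?P. edge_degree cends D c) + 2 * card ?C \<le> 2 * card D + 2 * card ?P"
    using sum_edge_degree_cends[OF DR(1)] by simp
  moreover have "card ?P \<le> ?W"
  proof -
    have "card ?P \<le> card ?L" using fin(1) by (rule card_image_le)
    also have "\<dots> = (\<Sum>v\<in>?L. 1)" by simp
    also have "\<dots> \<le> (\<Sum>v\<in>?L. 2 - edge_degree ends F v)" by (rule sum_mono) auto
    also have "\<dots> \<le> ?W" using finite_nodes by (intro sum_mono2) auto
    finally show ?thesis .
  qed
  moreover have "2 * card ?C \<le> ?W + 2 * card D1"
  proof -
    have "(\<Sum>c\<in>?C. 2) \<le> (\<Sum>c\<in>?C. ?w c + edge_degree cends D1 c)"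
      using class_deficiency by (rule sum_mono)
    moreover have "?W = (\<Sum>c\<in>?C. ?w c)" using finite_nodes by (rule sum.image_gen)
    ultimately show ?thesis using sum_edge_degree_cends[OF DR(2)] by (simp add: sum.distrib)
  qed
  \<comment> \<open>With \<open>N = card ?C\<close>, twice \<open>card_R_le\<close> and
    \<open>2 N \<le> ?W + 2 |D1|\<close> give \<open>2 |D| \<le> 2 N + ?W\<close>. The degree sum
    over \<open>?P\<close> is then at most \<open>2 |D| - 2 N + 2 |?P| \<le> 3 ?W\<close>.\<close>
  ultimately show ?thesis
    using T card_R_le[OF False] card_R unfolding D_def by linarith
qed simp

end

theorem theorem8:
  fixes V :: "'v set" and E :: "'e set" and ends :: "'e \<Rightarrow> 'v set"
    and E' F :: "'e set" and L0 L1 L2 L :: "'v set"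
  assumes "multigraph V E ends"
    and "two_edge_connected ends V E"
    and "minimal_2ec_spanning ends V E E'"
    and "F \<subseteq> E"
    and "forest ends F"
    and "\<forall>e \<in> E' - F. essential ends V (E' \<union> F) e"
    and "L0 = V - nodes_of ends F"
    and "L1 = {v \<in> nodes_of ends F. edge_degree ends F v = 1 \<and> incident_edges ends F v \<subseteq> E'}"
    and "L2 = {v \<in> nodes_of ends F. edge_degree ends F v = 1 \<and> incident_edges ends F v \<inter> E' = {}}"
    and "L = L0 \<union> L1 \<union> L2"
  shows "(\<Sum>v\<in>L. edge_degree ends E' v) \<le> 3 * (card L + card L0) + card L1"
proof -
  let ?H = "E' \<union> F"
  let ?d = "edge_degree ends F"
  have E'E: "E' \<subseteq> E" and E'2: "two_edge_connected ends V E'"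
    using assms(3) by (auto simp: minimal_2ec_spanning_def)
  have fin: "finite V" "finite F" "finite E'"
    using assms(1,4) E'E finite_subset by (auto simp: multigraph_def)
  have mH: "multigraph V ?H ends"
    using assms(1,4) E'E finite_subset by (auto simp: multigraph_def)
  \<comment> \<open>Adding edges keeps a graph connected; this transfers 2-edge-connectedness from
    \<open>E'\<close> to \<open>?H\<close>.\<close>
  have conn: "connected_graph ends V B" if "connected_graph ends V A" "A \<subseteq> B" for A B
    using that rtrancl_mono[OF adj_rel_mono[OF that(2)]] by (fastforce simp: connected_graph_def)
  have tH: "two_edge_connected ends V ?H"
    unfolding two_edge_connected_def
  proof (intro conjI ballI)
    show "connected_graph ends V ?H"
      using E'2 conn[of E' ?H] by (auto simp: two_edge_connected_def)
    fix e
    have "connected_graph ends V (E' - {e})"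
      using E'2 by (cases "e \<in> E'") (auto simp: two_edge_connected_def)
    then show "connected_graph ends V (?H - {e})" by (rule conn) auto
  qed
  interpret essential_outside_forest V ?H ends F
    using mH tH assms(5,6) by unfold_locales auto
  have nF: "nodes_of ends F \<subseteq> V"
    using ends_subset by (auto simp: nodes_of_def)
  have d0: "v \<in> nodes_of ends F \<longleftrightarrow> ?d v \<noteq> 0" for v
    using fin(2) by (auto simp: nodes_of_def edge_degree_def incident_edges_def)
  have L0: "L0 = {v \<in> V. ?d v = 0}" using assms(7) d0 by auto
  have L12: "L1 \<union> L2 = {v \<in> V. ?d v = 1}"
  proof -
    \<comment> \<open>The single forest edge at \<open>v\<close> is either in \<open>E'\<close> or
      not, so \<open>L1\<close> and \<open>L2\<close> exhaust the nodes of forest degree 1.\<close>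
    have "incident_edges ends F v \<subseteq> E' \<or> incident_edges ends F v \<inter> E' = {}" if "?d v = 1" for v
      using that by (auto simp: edge_degree_def card_1_singleton_iff)
    then show ?thesis using assms(8,9) d0 nF by auto
  qed
  have L: "L = {v \<in> V. ?d v < 2}" unfolding assms(10) Un_assoc L0 L12 by auto
  have finL: "finite L" unfolding L using fin(1) by simp
  have L1L: "L1 \<subseteq> L" unfolding assms(10) by blast
  \<comment> \<open>The deficiency is 2 on \<open>L0\<close>, 1 on the rest of \<open>L\<close> and
    0 elsewhere.\<close>
  have W: "(\<Sum>v\<in>V. 2 - ?d v) = card L + card L0"
  proof -
    have "(\<Sum>v\<in>V. 2 - ?d v) = (\<Sum>v\<in>V. (if ?d v < 2 then 1 else 0) + (if ?d v = 0 then 1 else 0))"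
      by (rule sum.cong) auto
    then show ?thesis using fin(1) by (simp add: sum.distrib L L0 flip: sum.inter_filter)
  qed
  \<comment> \<open>An edge of \<open>E'\<close> at \<open>v\<close> lies outside \<open>F\<close>
    or in \<open>F \<inter> E'\<close>; for \<open>v\<close> in \<open>L\<close> the second kind
    occurs only on \<open>L1\<close>, and then at most once.\<close>
  have "edge_degree ends E' v \<le> edge_degree ends (?H - F) v + (if v \<in> L1 then 1 else 0)"
    if v: "v \<in> L" for v
  proof -
    have "incident_edges ends E' v \<subseteq>
        incident_edges ends (?H - F) v \<union> (incident_edges ends F v \<inter> E')"
      by (auto simp: incident_edges_def)
    then have "edge_degree ends E' v
        \<le> card (incident_edges ends (?H - F) v \<union> (incident_edges ends F v \<inter> E'))"
      unfolding edge_degree_def using fin by (intro card_mono) (auto simp: incident_edges_def)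
    also have "\<dots> \<le> edge_degree ends (?H - F) v + card (incident_edges ends F v \<inter> E')"
      unfolding edge_degree_def by (rule card_Un_le)
    also have "card (incident_edges ends F v \<inter> E') \<le> (if v \<in> L1 then 1 else 0)"
    proof -
      have le: "card (incident_edges ends F v \<inter> E') \<le> ?d v"
        unfolding edge_degree_def using fin(2) by (intro card_mono) (auto simp: incident_edges_def)
      consider "v \<in> L0" | "v \<in> L1" | "v \<in> L2" using v assms(10) by blast
      then show ?thesis
      proof cases
        case 1
        then show ?thesis using le L0 by simp
      next
        case 2
        then show ?thesis using le assms(8) by simp
      next
        case 3
        then show ?thesis using assms(9) by simp
      qed
    qed
    finally show ?thesis by simp
  qed
  then have "(\<Sum>v\<in>L. edge_degree ends E' v)
      \<le> (\<Sum>v\<in>L. edge_degree ends (?H - F) v + (if v \<in> L1 then 1 else 0))"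
    by (rule sum_mono)
  also have "\<dots> = (\<Sum>v\<in>L. edge_degree ends (?H - F) v) + card L1"
  proof -
    have "{v \<in> L. v \<in> L1} = L1" using L1L by auto
    then show ?thesis using finL by (simp add: sum.distrib flip: sum.inter_filter)
  qed
  also have "\<dots> \<le> 3 * (card L + card L0) + card L1"
    using sum_degree_leaves_le unfolding W L by simp
  finally show ?thesis .
qed

end
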